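(* Let $R$ be a commutative ring with identity. Then the following conditions are equivalent. (1) For every $n\geq 1$, every rational monomial order $\prec$ on $R[X_1,\ldots,X_n]$, and every finitely generated ideal $I\subseteq R[X_1,\ldots,X_n]$, the leading term ideal $\operatorname{LT}_\prec(I)$ is finitely generated. (2) The ring $R$ is a Gröbner ring.
   Context: $\mathbb N=\{0,1,2,\ldots\}$, and for $\alpha\in\mathbb N^n$ write $X^\alpha=X_1^{\alpha_1}\cdots X_n^{\alpha_n}$. Monomial order: a total order $\prec$ on the monomials $X^\alpha$ ($\alpha\in\mathbb N^n$) such that $1\preceq X^\alpha$ for all $\alpha$; $X^\alpha\prec X^\beta$ implies $X^{\alpha+\gamma}\prec X^{\beta+\gamma}$ for all $\gamma\in\mathbb N^n$; and every nonempty set of monomials has a least element. For $u,v\in\mathbb R^m$, $u<_{\mathrm{lex}}v$ means that the first nonzero coordinate of $v-u$ exists and is positive. A monomial order $\prec$ on $R[X_1,\ldots,X_n]$ is rational if there are a finite $m$ and a matrix $Q\in\mathbb Q^{m\times n}$ such that $X^\alpha\prec X^\beta \Longleftrightarrow Q\alpha<_{\mathrm{lex}}Q\beta$ for all $\alpha,\beta\in\mathbb N^n$. Leading terms: for $0\neq f=\sum_\alpha c_\alpha X^\alpha$, let $X^{\alpha_0}$ be the $\prec$-largest monomial with nonzero coefficient in $f$; then $\operatorname{LT}_\prec(f)=c_{\alpha_0}X^{\alpha_0}$ (the coefficient is included). For an ideal $I$, $\operatorname{LT}_\prec(I)=\langle \operatorname{LT}_\prec(f)\mid 0\neq f\in I\rangle$.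 The lexicographic order with $X_1\succ\cdots\succ X_n$ is given by $X^a\prec_{\mathrm{lex}}X^b$ if and only if, at the first index $i$ with $a_i\ne b_i$, one has $a_i<b_i$. Gröbner ring: for $n\ge 1$, a commutative ring $R$ is $n$-Gröbner if for every finitely generated ideal $I\subseteq R[X_1,\ldots,X_n]$ the ideal $\operatorname{LT}_{\prec_{\mathrm{lex}}}(I)$ is finitely generated, where $\prec_{\mathrm{lex}}$ is the lexicographic order with $X_1\succ\cdots\succ X_n$. $R$ is a Gröbner ring if it is $n$-Gröbner for every $n\geq1$. (No coherence or discreteness assumption is made.) *)

theory Defs
  imports
    "HOL-Library.Poly_Mapping"
    "HOL-Algebra.Ideal"
    "Jordan_Normal_Form.Matrix"
begin

text \<open>
  Coefficient rings have sort \<open>{comm_ring, comm_monoid_mult}\<close>, that is, commutative rings with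
  identity in which \<open>0 = 1\<close> is allowed; \<open>comm_ring_1\<close> would exclude the zero ring.
  Polynomials are finitely supported functions from exponents to coefficients, and the variables
  \<open>X\<^sub>1, \<dots>, X\<^sub>n\<close> have the indices \<open>0, \<dots>, n - 1\<close>.
\<close>

type_synonym expo = "nat \<Rightarrow>\<^sub>0 nat"
type_synonym 'a mpol = "expo \<Rightarrow>\<^sub>0 'a"

definition expos :: "nat \<Rightarrow> expo set" where
  "expos n = {\<alpha>. Poly_Mapping.keys \<alpha> \<subseteq> {..<n}}"

text \<open>
  The identity is written \<open>Poly_Mapping.single 0 1\<close> because the library declares \<open>1\<close> on this type
  only for coefficients with \<open>0 \<noteq> 1\<close>.
\<close>

definition mpoly_ring :: "nat \<Rightarrow> ('a::{comm_ring,comm_monoid_mult}) mpol ring" where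
  "mpoly_ring n =
    \<lparr>carrier = {f. Poly_Mapping.keys f \<subseteq> expos n},
     monoid.mult = (*), one = Poly_Mapping.single 0 1, zero = 0, add = (+)\<rparr>"

definition fg_ideal :: "('b, 'm) ring_scheme \<Rightarrow> 'b set \<Rightarrow> bool" where
  "fg_ideal P I \<longleftrightarrow> (\<exists>S. finite S \<and> S \<subseteq> carrier P \<and> I = genideal P S)"

text \<open>
  An order on the monomials in \<open>n\<close> variables is given by its strict part on exponents;
  only its values on \<open>expos n\<close> matter.
\<close>

definition monomial_order :: "nat \<Rightarrow> (expo \<Rightarrow> expo \<Rightarrow> bool) \<Rightarrow> bool" where
  "monomial_order n prec \<longleftrightarrow>
    (\<forall>\<alpha>\<in>expos n. \<not> prec \<alpha> \<alpha>) \<and>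
    (\<forall>\<alpha>\<in>expos n. \<forall>\<beta>\<in>expos n. \<forall>\<gamma>\<in>expos n. prec \<alpha> \<beta> \<longrightarrow> prec \<beta> \<gamma> \<longrightarrow> prec \<alpha> \<gamma>) \<and>
    (\<forall>\<alpha>\<in>expos n. \<forall>\<beta>\<in>expos n. \<alpha> = \<beta> \<or> prec \<alpha> \<beta> \<or> prec \<beta> \<alpha>) \<and>
    (\<forall>\<alpha>\<in>expos n. 0 = \<alpha> \<or> prec 0 \<alpha>) \<and>
    (\<forall>\<alpha>\<in>expos n. \<forall>\<beta>\<in>expos n. \<forall>\<gamma>\<in>expos n. prec \<alpha> \<beta> \<longrightarrow> prec (\<alpha> + \<gamma>) (\<beta> + \<gamma>)) \<and>
    (\<forall>S. S \<subseteq> expos n \<longrightarrow> S \<noteq> {} \<longrightarrow> (\<exists>\<alpha>\<in>S. \<forall>\<beta>\<in>S. \<alpha> = \<beta> \<or> prec \<alpha> \<beta>))"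

definition lex_less :: "('b::linordered_idom) vec \<Rightarrow> 'b vec \<Rightarrow> bool" where
  "lex_less u v \<longleftrightarrow>
    (\<exists>k<dim_vec u. (\<forall>j<k. v $ j - u $ j = 0) \<and> v $ k - u $ k > 0)"

definition expo_vec :: "nat \<Rightarrow> expo \<Rightarrow> rat vec" where
  "expo_vec n \<alpha> = vec n (\<lambda>j. of_nat (Poly_Mapping.lookup \<alpha> j))"

definition rational_order :: "nat \<Rightarrow> (expo \<Rightarrow> expo \<Rightarrow> bool) \<Rightarrow> bool" where
  "rational_order n prec \<longleftrightarrow> monomial_order n prec \<and>
    (\<exists>m. \<exists>Q \<in> carrier_mat m n. \<forall>\<alpha>\<in>expos n. \<forall>\<beta>\<in>expos n.
       prec \<alpha> \<beta> \<longleftrightarrow> lex_less (Q *\<^sub>v expo_vec n \<alpha>) (Q *\<^sub>v expo_vec n \<beta>))"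

definition lex_order :: "nat \<Rightarrow> expo \<Rightarrow> expo \<Rightarrow> bool" where
  "lex_order n \<alpha> \<beta> \<longleftrightarrow>
    (\<exists>i<n. (\<forall>j<i. Poly_Mapping.lookup \<alpha> j = Poly_Mapping.lookup \<beta> j) \<and>
       Poly_Mapping.lookup \<alpha> i < Poly_Mapping.lookup \<beta> i)"

text \<open>The next two are meant for \<open>f \<noteq> 0\<close>.\<close>

definition lead_expo :: "(expo \<Rightarrow> expo \<Rightarrow> bool) \<Rightarrow> ('a::zero) mpol \<Rightarrow> expo" where
  "lead_expo prec f =
    (THE \<alpha>. \<alpha> \<in> Poly_Mapping.keys f \<and> (\<forall>\<beta>\<in>Poly_Mapping.keys f. \<beta> = \<alpha> \<or> prec \<beta> \<alpha>))"

definition LT :: "(expo \<Rightarrow> expo \<Rightarrow> bool) \<Rightarrow> ('a::zero) mpol \<Rightarrow> 'a mpol" where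
  "LT prec f = Poly_Mapping.single (lead_expo prec f) (Poly_Mapping.lookup f (lead_expo prec f))"

definition LT_ideal ::
  "nat \<Rightarrow> (expo \<Rightarrow> expo \<Rightarrow> bool) \<Rightarrow> ('a::{comm_ring,comm_monoid_mult}) mpol set \<Rightarrow> 'a mpol set" where
  "LT_ideal n prec I = genideal (mpoly_ring n) {LT prec f | f. f \<in> I \<and> f \<noteq> 0}"

definition n_groebner :: "nat \<Rightarrow> ('a::{comm_ring,comm_monoid_mult}) itself \<Rightarrow> bool" where
  "n_groebner n R \<longleftrightarrow>
    (\<forall>I :: 'a mpol set. fg_ideal (mpoly_ring n) I \<longrightarrow>
       fg_ideal (mpoly_ring n) (LT_ideal n (lex_order n) I))"

definition groebner_ring :: "('a::{comm_ring,comm_monoid_mult}) itself \<Rightarrow> bool" where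
  "groebner_ring R \<longleftrightarrow> (\<forall>n\<ge>1. n_groebner n R)"

end

theory Submission
  imports Defs
begin

text \<open>
  Lexicographic orders are rational (take the identity matrix), so only the passage from a Groebner
  ring to an arbitrary rational order \<open>\<prec>\<close>, given by a matrix \<open>Q\<close> with \<open>m\<close> rows, needs an idea.
  The idea is to make the rows of \<open>Q\<close> visible as extra variables and to homogenise.

  Clearing denominators and adding large multiples of each row to the later ones leaves the order
  unchanged. Since \<open>1 \<prec> X\<^sub>j\<close>, the first nonzero entry of every column is positive, so this
  process can be made to end in a matrix \<open>W\<close> of natural numbers (\<open>nat_weights_exist\<close>). Now put
  \<open>m\<close> new variables \<open>Y\<close> in front of \<open>X\<close> and let \<open>\<phi>\<close> be the ring homomorphism with
  \<open>\<phi> (X\<^sup>\<alpha>) = Y\<^sup>W\<^sup>\<alpha> X\<^sup>\<alpha>\<close>, and \<open>\<psi>\<close> the one that sets \<open>Y = 1\<close>. The lexicographic order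
  of the larger ring compares \<open>\<phi> (X\<^sup>\<alpha>)\<close> and \<open>\<phi> (X\<^sup>\<beta>)\<close> in the way \<open>\<prec>\<close> compares \<open>X\<^sup>\<alpha>\<close> and
  \<open>X\<^sup>\<beta>\<close>.

  For \<open>I = \<langle>f\<^sub>1, \<dots>, f\<^sub>s\<rangle>\<close> let \<open>J = \<langle>\<phi> f\<^sub>1, \<dots>, \<phi> f\<^sub>s\<rangle>\<close>. The claim is that \<open>\<psi>\<close> maps the
  leading terms of \<open>J\<close> exactly onto those of \<open>I\<close>; then the images under \<open>\<psi>\<close> of finitely many
  generators of \<open>LT J\<close> generate \<open>LT I\<close>. The leading terms of \<open>I\<close> are reached because
  \<open>LT (\<phi> f) = \<phi> (LT f)\<close>. For the other inclusion, give \<open>Y\<^sup>a X\<^sup>\<alpha>\<close> the degree \<open>a - W \<alpha>\<close>. All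
  \<open>\<phi> f\<close> have degree \<open>0\<close>, so every homogeneous component of \<open>g \<in> J\<close> is mapped into \<open>I\<close> by \<open>\<psi>\<close>
  (\<open>component_in_ideal\<close>). Take the component that contains the leading term of \<open>g\<close>. On monomials
  of one degree \<open>\<psi>\<close> is injective and turns the lexicographic order into \<open>\<prec>\<close>
  (\<open>prec_component\<close>), so the leading term of the image is \<open>\<psi> (LT g)\<close>.
\<close>

section \<open>Relabelling exponents\<close>

text \<open>
  One operator serves for three purposes: with \<open>S = UNIV\<close> and \<open>h\<close> additive it is the ring homomorphism
  \<open>X\<^sup>a \<mapsto> X\<^sup>h\<^sup>a\<close>, with \<open>h\<close> the identity it cuts out the part of \<open>f\<close> supported in \<open>S\<close>,
  and in general it does the cutting first and the substitution next.
\<close>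

definition relabel :: "expo set \<Rightarrow> (expo \<Rightarrow> expo) \<Rightarrow> ('a::comm_monoid_add) mpol \<Rightarrow> 'a mpol" where
  "relabel S h f =
    (\<Sum>a\<in>Poly_Mapping.keys f. if a \<in> S then Poly_Mapping.single (h a) (Poly_Mapping.lookup f a) else 0)"

lemma relabel_0 [simp]: "relabel S h 0 = 0"
  by (simp add: relabel_def)

lemma relabel_add: "relabel S h (f + g) = relabel S h f + relabel S h g"
  unfolding relabel_def
  by (rule setsum_keys_plus_distrib) (auto simp: single_add)

lemma relabel_sum: "relabel S h (sum F A) = (\<Sum>x\<in>A. relabel S h (F x))"
  by (induction A rule: infinite_finite_induct) (auto simp: relabel_add)

lemma relabel_single:
  "relabel S h (Poly_Mapping.single a c) = (if a \<in> S then Poly_Mapping.single (h a) c else 0)"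
  by (simp add: relabel_def)

lemma mpol_monomial_sum:
  "f = (\<Sum>a\<in>Poly_Mapping.keys f. Poly_Mapping.single a (Poly_Mapping.lookup f a))"
  by (rule poly_mapping_eqI) (auto simp: lookup_sum lookup_single in_keys_iff when_def sum.delta)

text \<open>
  If the exponents of \<open>f\<close> translate \<open>S\<close> to itself and its complement to itself, then cutting out \<open>S\<close>
  is linear over \<open>f\<close>. For \<open>S\<close> a degree class and \<open>f\<close> homogeneous of degree \<open>0\<close> this says that
  taking homogeneous components commutes with multiplication by \<open>f\<close>.
\<close>

lemma relabel_mult:
  fixes g f :: "('a::comm_semiring_0) mpol"
  assumes hom: "\<And>a b. h (a + b) = h a + h b"
    and S: "\<And>a c. c \<in> Poly_Mapping.keys f \<Longrightarrow> a + c \<in> S \<longleftrightarrow> a \<in> S"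
  shows "relabel S h (g * f) = relabel S h g * relabel UNIV h f"
proof -
  have "g * f = (\<Sum>a\<in>Poly_Mapping.keys g. \<Sum>c\<in>Poly_Mapping.keys f.
      Poly_Mapping.single (a + c) (Poly_Mapping.lookup g a * Poly_Mapping.lookup f c))"
    by (subst mpol_monomial_sum[of g], subst mpol_monomial_sum[of f])
      (simp add: sum_product mult_single)
  then have "relabel S h (g * f) = (\<Sum>a\<in>Poly_Mapping.keys g. \<Sum>c\<in>Poly_Mapping.keys f.
      if a + c \<in> S then Poly_Mapping.single (h (a + c))
        (Poly_Mapping.lookup g a * Poly_Mapping.lookup f c) else 0)"
    by (simp only: relabel_sum relabel_single)
  also have "\<dots> = (\<Sum>a\<in>Poly_Mapping.keys g. \<Sum>c\<in>Poly_Mapping.keys f.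
      if a \<in> S then Poly_Mapping.single (h a + h c)
        (Poly_Mapping.lookup g a * Poly_Mapping.lookup f c) else 0)"
    by (intro sum.cong refl) (simp add: hom S)
  also have "\<dots> = relabel S h g * relabel UNIV h f"
    unfolding relabel_def sum_product
    by (intro sum.cong refl) (auto simp: mult_single)
  finally show ?thesis .
qed

lemma keys_relabel_subset: "Poly_Mapping.keys (relabel S h f) \<subseteq> h ` (Poly_Mapping.keys f \<inter> S)"
  unfolding relabel_def
  by (rule order_trans[OF keys_sum]) (auto split: if_splits)

lemma lookup_relabel:
  assumes "inj_on h S" "a \<in> S"
  shows "Poly_Mapping.lookup (relabel S h f) (h a) = Poly_Mapping.lookup f a"
proof -
  have "Poly_Mapping.lookup (relabel S h f) (h a) =
      (\<Sum>b\<in>Poly_Mapping.keys f. if b = a then Poly_Mapping.lookup f b else 0)"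
    unfolding relabel_def lookup_sum
    by (rule sum.cong) (use assms in \<open>auto simp: lookup_single when_def inj_on_def\<close>)
  then show ?thesis by (simp add: in_keys_iff)
qed

lemma relabel_id:
  assumes "\<And>a. h a = a"
  shows "relabel UNIV h f = f"
  unfolding relabel_def by (simp add: assms mpol_monomial_sum[symmetric])

lemma relabel_relabel:
  "relabel UNIV h (relabel UNIV k f) = relabel UNIV (\<lambda>a. h (k a)) f"
  by (simp add: relabel_def[of UNIV k] relabel_sum relabel_single) (simp add: relabel_def)

section \<open>Ideals of polynomial rings\<close>

lemma mpoly_ring_simps [simp]:
  "carrier (mpoly_ring n) = {f. Poly_Mapping.keys f \<subseteq> expos n}"
  "x \<otimes>\<^bsub>mpoly_ring n\<^esub> y = x * y" "\<one>\<^bsub>mpoly_ring n\<^esub> = Poly_Mapping.single 0 1"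
  "\<zero>\<^bsub>mpoly_ring n\<^esub> = 0" "x \<oplus>\<^bsub>mpoly_ring n\<^esub> y = x + y"
  by (simp_all add: mpoly_ring_def)

lemma expos_0 [simp]: "0 \<in> expos n"
  by (simp add: expos_def)

lemma expos_add: "\<alpha> \<in> expos n \<Longrightarrow> \<beta> \<in> expos n \<Longrightarrow> \<alpha> + \<beta> \<in> expos n"
  unfolding expos_def using keys_add[of \<alpha> \<beta>] by auto

lemma mpol_one_mult:
  "Poly_Mapping.single 0 1 * f = (f :: ('a::{comm_ring,comm_monoid_mult}) mpol)"
  by (subst (1 2) mpol_monomial_sum[of f]) (simp add: sum_distrib_left mult_single)

lemma carrier_mult:
  fixes f g :: "('a::{comm_ring,comm_monoid_mult}) mpol"
  assumes "Poly_Mapping.keys f \<subseteq> expos n" "Poly_Mapping.keys g \<subseteq> expos n"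
  shows "Poly_Mapping.keys (f * g) \<subseteq> expos n"
proof
  fix c assume "c \<in> Poly_Mapping.keys (f * g)"
  then obtain a b where "c = a + b" "a \<in> Poly_Mapping.keys f" "b \<in> Poly_Mapping.keys g"
    using keys_mult[of f g] by blast
  then show "c \<in> expos n" using assms by (auto intro!: expos_add)
qed

lemma carrier_add:
  fixes f g :: "('a::{comm_ring,comm_monoid_mult}) mpol"
  assumes "Poly_Mapping.keys f \<subseteq> expos n" "Poly_Mapping.keys g \<subseteq> expos n"
  shows "Poly_Mapping.keys (f + g) \<subseteq> expos n"
  using keys_add[of f g] assms by blast

lemma keys_relabel_expos:
  assumes "Poly_Mapping.keys f \<subseteq> expos n" "h ` expos n \<subseteq> expos n'"
  shows "Poly_Mapping.keys (relabel S h f) \<subseteq> expos n'"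
proof -
  have "h ` (Poly_Mapping.keys f \<inter> S) \<subseteq> expos n'" using assms by auto
  then show ?thesis using keys_relabel_subset[of S h f] by (simp add: subset_trans)
qed

lemma cring_mpoly_ring: "cring (mpoly_ring n :: ('a::{comm_ring,comm_monoid_mult}) mpol ring)"
proof (rule cringI)
  show "abelian_group (mpoly_ring n :: 'a mpol ring)"
  proof (rule abelian_groupI)
    fix x :: "'a mpol" assume "x \<in> carrier (mpoly_ring n)"
    moreover have "Poly_Mapping.keys (- x) = Poly_Mapping.keys x"
      by (auto simp: in_keys_iff)
    ultimately show "\<exists>y\<in>carrier (mpoly_ring n). y \<oplus>\<^bsub>mpoly_ring n\<^esub> x = \<zero>\<^bsub>mpoly_ring n\<^esub>"
      by (intro bexI[of _ "- x"]) auto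
    show "x \<oplus>\<^bsub>mpoly_ring n\<^esub> y = y \<oplus>\<^bsub>mpoly_ring n\<^esub> x" for y
      by (simp add: add.commute)
  qed (simp_all add: carrier_add add.assoc)
  show "Group.comm_monoid (mpoly_ring n :: 'a mpol ring)"
  proof (rule comm_monoidI)
    show "x \<otimes>\<^bsub>mpoly_ring n\<^esub> y \<in> carrier (mpoly_ring n)"
      if "x \<in> carrier (mpoly_ring n)" "y \<in> carrier (mpoly_ring n)" for x y :: "'a mpol"
      using that by (simp add: carrier_mult)
    show "x \<otimes>\<^bsub>mpoly_ring n\<^esub> y = y \<otimes>\<^bsub>mpoly_ring n\<^esub> x" for x y :: "'a mpol"
      by (simp add: mult.commute)
  qed (simp_all add: mult.assoc mpol_one_mult)
qed (simp add: distrib_right)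

lemma ring_mpoly_ring: "ring (mpoly_ring n :: ('a::{comm_ring,comm_monoid_mult}) mpol ring)"
  using cring_mpoly_ring by (rule cring.axioms)

lemma mpoly_idealI:
  fixes I :: "('a::{comm_ring,comm_monoid_mult}) mpol set"
  assumes sub: "I \<subseteq> carrier (mpoly_ring n)" and zero: "0 \<in> I"
    and add: "\<And>a b. a \<in> I \<Longrightarrow> b \<in> I \<Longrightarrow> a + b \<in> I"
    and mult: "\<And>a x. a \<in> I \<Longrightarrow> x \<in> carrier (mpoly_ring n) \<Longrightarrow> x * a \<in> I"
  shows "ideal I (mpoly_ring n)"
proof -
  interpret R: cring "mpoly_ring n :: 'a mpol ring" by (rule cring_mpoly_ring)
  \<comment> \<open>Negatives come from multiplication by \<open>-1\<close>.\<close>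
  have neg: "\<ominus>\<^bsub>mpoly_ring n\<^esub> a \<in> I" if "a \<in> I" for a
  proof -
    have a: "a \<in> carrier (mpoly_ring n)" using that sub by auto
    have "\<ominus>\<^bsub>mpoly_ring n\<^esub> a = (\<ominus>\<^bsub>mpoly_ring n\<^esub> \<one>\<^bsub>mpoly_ring n\<^esub>) \<otimes>\<^bsub>mpoly_ring n\<^esub> a"
      by (simp only: R.l_minus[OF R.one_closed a] R.l_one[OF a])
    also have "\<dots> \<in> I"
      using mult[OF that R.a_inv_closed[OF R.one_closed]] by (simp only: mpoly_ring_simps)
    finally show ?thesis .
  qed
  show ?thesis
  proof (rule idealI[OF ring_mpoly_ring])
    show "subgroup I (add_monoid (mpoly_ring n))"
    proof (rule subgroup.intro)
      show "I \<subseteq> carrier (add_monoid (mpoly_ring n))"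
        using sub by (simp only: partial_object.simps)
      show "x \<otimes>\<^bsub>add_monoid (mpoly_ring n)\<^esub> y \<in> I" if "x \<in> I" "y \<in> I" for x y
        using add[OF that] by (simp only: monoid.simps mpoly_ring_simps)
      show "\<one>\<^bsub>add_monoid (mpoly_ring n)\<^esub> \<in> I"
        using zero by (simp only: monoid.simps mpoly_ring_simps)
      show "inv\<^bsub>add_monoid (mpoly_ring n)\<^esub> x \<in> I" if "x \<in> I" for x
        using neg[OF that] by (simp only: a_inv_def)
    qed
    show "a \<otimes>\<^bsub>mpoly_ring n\<^esub> x \<in> I" if "a \<in> I" "x \<in> carrier (mpoly_ring n)" for a x
      using mult[OF that] by (simp only: mpoly_ring_simps mult.commute[of a x])
    show "x \<otimes>\<^bsub>mpoly_ring n\<^esub> a \<in> I" if "a \<in> I" "x \<in> carrier (mpoly_ring n)" for a x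
      using mult[OF that] by (simp only: mpoly_ring_simps)
  qed
qed

lemma mpoly_idealD:
  fixes I :: "('a::{comm_ring,comm_monoid_mult}) mpol set"
  assumes "ideal I (mpoly_ring n)"
  shows "I \<subseteq> carrier (mpoly_ring n)" "0 \<in> I"
    "\<And>a b. a \<in> I \<Longrightarrow> b \<in> I \<Longrightarrow> a + b \<in> I"
    "\<And>a x. a \<in> I \<Longrightarrow> x \<in> carrier (mpoly_ring n) \<Longrightarrow> x * a \<in> I"
proof -
  note sub = ideal.axioms(1)[OF assms]
  show "I \<subseteq> carrier (mpoly_ring n)" by (rule additive_subgroup.a_subset[OF sub])
  show "0 \<in> I" using additive_subgroup.zero_closed[OF sub] by (simp only: mpoly_ring_simps)
  show "a + b \<in> I" if "a \<in> I" "b \<in> I" for a b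
    using additive_subgroup.a_closed[OF sub that] by (simp only: mpoly_ring_simps)
  show "x * a \<in> I" if "a \<in> I" "x \<in> carrier (mpoly_ring n)" for a x
    using ideal.I_l_closed[OF assms that] by (simp only: mpoly_ring_simps)
qed

lemma relabel_genideal_subset:
  fixes A :: "('a::{comm_ring,comm_monoid_mult}) mpol set"
  assumes hom: "\<And>a b. h (a + b) = h a + h b" and h: "h ` expos n \<subseteq> expos n'"
    and A: "A \<subseteq> carrier (mpoly_ring n)" and K: "ideal K (mpoly_ring n')"
    and AK: "relabel UNIV h ` A \<subseteq> K"
  shows "relabel UNIV h ` genideal (mpoly_ring n) A \<subseteq> K"
proof -
  note KD = mpoly_idealD[OF K]
  interpret R: ring "mpoly_ring n :: 'a mpol ring" by (rule ring_mpoly_ring)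
  let ?L = "{g \<in> carrier (mpoly_ring n). relabel UNIV h g \<in> K}"
  have "ideal ?L (mpoly_ring n)"
  proof (rule mpoly_idealI)
    fix a x :: "'a mpol" assume a: "a \<in> ?L" and x: "x \<in> carrier (mpoly_ring n)"
    have "relabel UNIV h (x * a) = relabel UNIV h x * relabel UNIV h a"
      by (rule relabel_mult[OF hom]) auto
    moreover have "relabel UNIV h x \<in> carrier (mpoly_ring n')"
      using keys_relabel_expos[OF _ h] x by simp
    ultimately have "relabel UNIV h (x * a) \<in> K" using KD(4) a by auto
    then show "x * a \<in> ?L" using a x by (simp add: carrier_mult)
  qed (auto simp: KD(2,3) relabel_add carrier_add[THEN subsetD])
  moreover have "A \<subseteq> ?L" using A AK by auto
  ultimately have "genideal (mpoly_ring n) A \<subseteq> ?L" by (rule R.genideal_minimal)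
  then show ?thesis by auto
qed

section \<open>Leading exponents\<close>

lemma monomial_orderD:
  assumes "monomial_order n prec" "\<alpha> \<in> expos n" "\<beta> \<in> expos n"
  shows "\<not> prec \<alpha> \<alpha>" "\<alpha> = \<beta> \<or> prec \<alpha> \<beta> \<or> prec \<beta> \<alpha>" "prec \<alpha> \<beta> \<Longrightarrow> \<not> prec \<beta> \<alpha>"
    "0 = \<alpha> \<or> prec 0 \<alpha>" "\<gamma> \<in> expos n \<Longrightarrow> prec \<alpha> \<beta> \<Longrightarrow> prec \<beta> \<gamma> \<Longrightarrow> prec \<alpha> \<gamma>"
    "\<gamma> \<in> expos n \<Longrightarrow> prec \<alpha> \<beta> \<longleftrightarrow> prec (\<alpha> + \<gamma>) (\<beta> + \<gamma>)"
proof -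
  note ax = assms(1)[unfolded monomial_order_def]
  note irrefl = conjunct1[OF ax, rule_format]
  note ax = conjunct2[OF ax]
  note trans = conjunct1[OF ax, rule_format]
  note ax = conjunct2[OF ax]
  note total = conjunct1[OF ax, rule_format]
  note ax = conjunct2[OF ax]
  note least = conjunct1[OF ax, rule_format]
  note ax = conjunct2[OF ax]
  note shift = conjunct1[OF ax, rule_format]
  show "\<not> prec \<alpha> \<alpha>" by (rule irrefl[OF assms(2)])
  show "\<alpha> = \<beta> \<or> prec \<alpha> \<beta> \<or> prec \<beta> \<alpha>" by (rule total[OF assms(2,3)])
  show "0 = \<alpha> \<or> prec 0 \<alpha>" by (rule least[OF assms(2)])
  show "\<not> prec \<beta> \<alpha>" if "prec \<alpha> \<beta>"
    using trans[OF assms(2,3,2) that] irrefl[OF assms(2)] by blast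
  show "prec \<alpha> \<gamma>" if "\<gamma> \<in> expos n" "prec \<alpha> \<beta>" "prec \<beta> \<gamma>"
    by (rule trans[OF assms(2,3) that])
  show "prec \<alpha> \<beta> \<longleftrightarrow> prec (\<alpha> + \<gamma>) (\<beta> + \<gamma>)" if \<gamma>: "\<gamma> \<in> expos n"
  proof
    show "prec (\<alpha> + \<gamma>) (\<beta> + \<gamma>)" if "prec \<alpha> \<beta>"
      by (rule shift[OF assms(2,3) \<gamma> that])
    assume *: "prec (\<alpha> + \<gamma>) (\<beta> + \<gamma>)"
    have e: "\<alpha> + \<gamma> \<in> expos n" "\<beta> + \<gamma> \<in> expos n"
      using assms(2,3) \<gamma> by (auto intro: expos_add)
    have "\<alpha> \<noteq> \<beta>" using * irrefl[OF e(1)] by auto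
    moreover have "\<not> prec \<beta> \<alpha>"
    proof
      assume "prec \<beta> \<alpha>"
      then have "prec (\<beta> + \<gamma>) (\<alpha> + \<gamma>)" by (rule shift[OF assms(3,2) \<gamma>])
      then show False using trans[OF e(1,2,1) *] irrefl[OF e(1)] by blast
    qed
    ultimately show "prec \<alpha> \<beta>" using total[OF assms(2,3)] by blast
  qed
qed

lemma lead_expo_eqI:
  assumes mo: "monomial_order n prec" and f: "Poly_Mapping.keys f \<subseteq> expos n"
    and a: "a \<in> Poly_Mapping.keys f" "\<And>b. b \<in> Poly_Mapping.keys f \<Longrightarrow> b = a \<or> prec b a"
  shows "lead_expo prec f = a"
  unfolding lead_expo_def
proof (rule the_equality)
  fix c assume c: "c \<in> Poly_Mapping.keys f \<and> (\<forall>\<beta>\<in>Poly_Mapping.keys f. \<beta> = c \<or> prec \<beta> c)"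
  show "c = a"
  proof (rule ccontr)
    assume "c \<noteq> a"
    then have "prec c a" "prec a c" using a c by auto
    moreover have "c \<in> expos n" "a \<in> expos n" using f a(1) c by auto
    ultimately show False using monomial_orderD(3)[OF mo] by simp
  qed
qed (use a in auto)

lemma finite_has_greatest:
  assumes mo: "monomial_order n prec"
  shows "finite A \<Longrightarrow> A \<noteq> {} \<Longrightarrow> A \<subseteq> expos n \<Longrightarrow> \<exists>a\<in>A. \<forall>b\<in>A. b = a \<or> prec b a"
proof (induction A rule: finite_ne_induct)
  case (insert x A)
  then obtain a where a: "a \<in> A" "\<forall>b\<in>A. b = a \<or> prec b a" by auto
  have e: "a \<in> expos n" "x \<in> expos n" using insert a by auto
  consider "x = a" | "prec x a" | "prec a x" using monomial_orderD(2)[OF mo e] by blast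
  then show ?case
  proof cases
    case 3
    have "prec b x" if "b \<in> A" for b
    proof (cases "b = a")
      case False
      then have "prec b a" using a(2) that by auto
      moreover have "b \<in> expos n" using insert.prems that by auto
      ultimately show ?thesis using monomial_orderD(5)[OF mo _ e(1,2)] 3 by simp
    qed (use 3 in simp)
    then show ?thesis by auto
  qed (use a in auto)
qed auto

lemma lead_expo:
  assumes mo: "monomial_order n prec" and f: "Poly_Mapping.keys f \<subseteq> expos n" and "f \<noteq> 0"
  shows "lead_expo prec f \<in> Poly_Mapping.keys f"
    "\<And>b. b \<in> Poly_Mapping.keys f \<Longrightarrow> b = lead_expo prec f \<or> prec b (lead_expo prec f)"
proof -
  have "Poly_Mapping.keys f \<noteq> {}" using \<open>f \<noteq> 0\<close>
    by (metis ex_in_conv in_keys_iff lookup_zero poly_mapping_eqI)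
  from finite_has_greatest[OF mo finite_keys this f] obtain a
    where a: "a \<in> Poly_Mapping.keys f" "\<forall>b\<in>Poly_Mapping.keys f. b = a \<or> prec b a" by blast
  then have "lead_expo prec f = a" by (intro lead_expo_eqI[OF mo f]) auto
  with a show "lead_expo prec f \<in> Poly_Mapping.keys f"
    "\<And>b. b \<in> Poly_Mapping.keys f \<Longrightarrow> b = lead_expo prec f \<or> prec b (lead_expo prec f)" by auto
qed

lemma LT_carrier:
  assumes mo: "monomial_order n prec" and f: "Poly_Mapping.keys f \<subseteq> expos n" and "f \<noteq> 0"
  shows "Poly_Mapping.keys (LT prec f) \<subseteq> expos n"
  using lead_expo(1)[OF assms] f by (auto simp: LT_def)

text \<open>
  Injectivity of \<open>h\<close> on \<open>S\<close> prevents cancellation, so the leading exponent survives with its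
  coefficient; as it lies in \<open>S\<close>, it remains the largest one.
\<close>

lemma LT_relabel:
  assumes mo: "monomial_order n prec" and mo': "monomial_order n' prec'"
    and f: "Poly_Mapping.keys f \<subseteq> expos n" "f \<noteq> 0"
    and h: "h ` expos n \<subseteq> expos n'" "inj_on h S" and S: "lead_expo prec f \<in> S"
    and mono: "\<forall>b\<in>expos n \<inter> S. prec b (lead_expo prec f) \<longrightarrow> prec' (h b) (h (lead_expo prec f))"
  shows "relabel S h f \<noteq> 0" "LT prec' (relabel S h f) = relabel UNIV h (LT prec f)"
proof -
  let ?a = "lead_expo prec f"
  note a = lead_expo[OF mo f]
  have look: "Poly_Mapping.lookup (relabel S h f) (h ?a) = Poly_Mapping.lookup f ?a"
    using h S by (simp add: lookup_relabel)
  then have key: "h ?a \<in> Poly_Mapping.keys (relabel S h f)" using a(1) by (simp add: in_keys_iff)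
  then show "relabel S h f \<noteq> 0" by auto
  have "lead_expo prec' (relabel S h f) = h ?a"
  proof (rule lead_expo_eqI[OF mo' _ key])
    show "Poly_Mapping.keys (relabel S h f) \<subseteq> expos n'"
      by (rule keys_relabel_expos[OF f(1) h(1)])
    fix c assume "c \<in> Poly_Mapping.keys (relabel S h f)"
    then obtain b where "b \<in> Poly_Mapping.keys f" "b \<in> S" "c = h b"
      using keys_relabel_subset[of S h f] by blast
    then show "c = h ?a \<or> prec' c (h ?a)" using a(2)[of b] mono f by blast
  qed
  then show "LT prec' (relabel S h f) = relabel UNIV h (LT prec f)"
    by (simp add: LT_def relabel_single look)
qed

section \<open>Transfer of leading term ideals along a homogenisation\<close>

text \<open>
  \<open>\<Phi>\<close> and \<open>\<pi>\<close> are the effects of \<open>\<phi>\<close> and \<open>\<psi>\<close> on exponents. The transfer works for every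
  additive section \<open>\<Phi>\<close> of \<open>\<pi>\<close> that preserves and reflects the order.
\<close>

locale expo_embedding =
  fixes n N :: nat and prec prec' :: "expo \<Rightarrow> expo \<Rightarrow> bool" and \<Phi> \<pi> :: "expo \<Rightarrow> expo"
  assumes mo: "monomial_order n prec" and mo': "monomial_order N prec'"
    and \<Phi>_add: "\<And>a b. \<Phi> (a + b) = \<Phi> a + \<Phi> b" and \<pi>_add: "\<And>a b. \<pi> (a + b) = \<pi> a + \<pi> b"
    and \<pi>_\<Phi>: "\<And>a. \<pi> (\<Phi> a) = a"
    and \<Phi>_expos: "\<Phi> ` expos n \<subseteq> expos N"
    and \<pi>_expos: "\<pi> ` expos N \<subseteq> expos n"
    and prec_\<Phi>: "\<And>a b. a \<in> expos n \<Longrightarrow> b \<in> expos n \<Longrightarrow> prec a b \<longleftrightarrow> prec' (\<Phi> a) (\<Phi> b)"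
begin

lemma inj_\<Phi>: "inj_on \<Phi> A"
  by (metis \<pi>_\<Phi> inj_onI)

lemma relabel_\<pi>_\<Phi>: "relabel UNIV \<pi> (relabel UNIV \<Phi> f) = f"
  by (simp add: relabel_relabel relabel_id \<pi>_\<Phi>)

lemma relabel_\<Phi>_carrier: "f \<in> carrier (mpoly_ring n) \<Longrightarrow> relabel S \<Phi> f \<in> carrier (mpoly_ring N)"
  using keys_relabel_expos[OF _ \<Phi>_expos] by simp

lemma relabel_\<pi>_carrier: "f \<in> carrier (mpoly_ring N) \<Longrightarrow> relabel S \<pi> f \<in> carrier (mpoly_ring n)"
  using keys_relabel_expos[OF _ \<pi>_expos] by simp

text \<open>
  The degree of \<open>a\<close> is \<open>a - \<Phi> (\<pi> a)\<close>, which may have negative entries; equality of the degrees of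
  \<open>a\<close> and \<open>b\<close> is therefore written without subtraction.
\<close>

definition component :: "expo \<Rightarrow> expo set" where
  "component b = {a. a + \<Phi> (\<pi> b) = b + \<Phi> (\<pi> a)}"

lemma component_self: "b \<in> component b"
  by (simp add: component_def)

lemma component_add_\<Phi>: "a + \<Phi> c \<in> component b \<longleftrightarrow> a \<in> component b"
proof -
  have "a + \<Phi> c + \<Phi> (\<pi> b) = b + \<Phi> (\<pi> (a + \<Phi> c)) \<longleftrightarrow>
      (a + \<Phi> (\<pi> b)) + \<Phi> c = (b + \<Phi> (\<pi> a)) + \<Phi> c"
    by (simp add: \<pi>_add \<pi>_\<Phi> \<Phi>_add ac_simps)
  then show ?thesis by (simp add: component_def)
qed

lemma inj_on_component: "inj_on \<pi> (component b)"
proof (rule inj_onI)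
  fix x y assume "x \<in> component b" "y \<in> component b" "\<pi> x = \<pi> y"
  then have "x + \<Phi> (\<pi> b) = y + \<Phi> (\<pi> b)" by (simp add: component_def)
  then show "x = y" by simp
qed

text \<open>
  In one degree class \<open>a\<close> and \<open>b\<close> differ by the same vector as \<open>\<Phi> (\<pi> a)\<close> and \<open>\<Phi> (\<pi> b)\<close>, and a
  monomial order only depends on the difference.
\<close>

lemma prec_component:
  assumes "a \<in> expos N" "b \<in> expos N" "a \<in> component b" "prec' a b"
  shows "prec (\<pi> a) (\<pi> b)"
proof -
  have e: "\<Phi> (\<pi> a) \<in> expos N" "\<Phi> (\<pi> b) \<in> expos N"
    using assms \<Phi>_expos \<pi>_expos by auto
  have "prec' (a + \<Phi> (\<pi> b)) (b + \<Phi> (\<pi> b))"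
    using monomial_orderD(6)[OF mo' assms(1,2) e(2)] assms(4) by blast
  then have "prec' (\<Phi> (\<pi> a) + b) (\<Phi> (\<pi> b) + b)"
    using assms(3) by (simp add: component_def add.commute)
  then have "prec' (\<Phi> (\<pi> a)) (\<Phi> (\<pi> b))"
    using monomial_orderD(6)[OF mo' e assms(2)] by blast
  then show ?thesis using prec_\<Phi>[of "\<pi> a" "\<pi> b"] assms \<pi>_expos by auto
qed

text \<open>
  Multiplication by a monomial moves the components of \<open>g\<close> to other degrees, which need not be the
  degree of any exponent. The property is therefore strengthened to all multiples of \<open>g\<close>, with the
  degree class fixed; in this form it defines an ideal, and the case of the multiple \<open>1 * g\<close>
  is the claim.
\<close>

lemma component_in_ideal:
  fixes I :: "('a::{comm_ring,comm_monoid_mult}) mpol set"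
  assumes I: "ideal I (mpoly_ring n)" and F: "F \<subseteq> I"
    and g: "g \<in> genideal (mpoly_ring N) (relabel UNIV \<Phi> ` F)"
  shows "relabel (component b) \<pi> g \<in> I"
proof -
  note ID = mpoly_idealD[OF I]
  let ?K = "{g \<in> carrier (mpoly_ring N).
    \<forall>h\<in>carrier (mpoly_ring N). relabel (component b) \<pi> (h * g) \<in> I}"
  interpret R: ring "mpoly_ring N :: 'a mpol ring" by (rule ring_mpoly_ring)
  have "ideal ?K (mpoly_ring N)"
  proof (rule mpoly_idealI)
    fix a x :: "'a mpol" assume a: "a \<in> ?K" and x: "x \<in> carrier (mpoly_ring N)"
    have "relabel (component b) \<pi> (h * (x * a)) \<in> I" if "h \<in> carrier (mpoly_ring N)" for h
    proof -
      have "h * x \<in> carrier (mpoly_ring N)" using x that by (simp add: carrier_mult)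
      then have "relabel (component b) \<pi> (h * x * a) \<in> I" using a by blast
      then show ?thesis by (simp add: mult.assoc)
    qed
    then show "x * a \<in> ?K" using a x by (simp add: carrier_mult)
  qed (auto simp: ID(2,3) distrib_left relabel_add carrier_add[THEN subsetD])
  moreover have "relabel UNIV \<Phi> ` F \<subseteq> ?K"
  proof (rule image_subsetI)
    fix f assume f: "f \<in> F"
    have fI: "f \<in> I" and fc: "f \<in> carrier (mpoly_ring n)" using f F ID(1) by auto
    have "relabel (component b) \<pi> (h * relabel UNIV \<Phi> f) \<in> I"
      if h: "h \<in> carrier (mpoly_ring N)" for h
    proof -
      have "relabel (component b) \<pi> (h * relabel UNIV \<Phi> f) =
          relabel (component b) \<pi> h * relabel UNIV \<pi> (relabel UNIV \<Phi> f)"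
        by (rule relabel_mult[OF \<pi>_add])
          (use keys_relabel_subset[of UNIV \<Phi> f] in \<open>auto simp: component_add_\<Phi>\<close>)
      then show ?thesis
        using ID(4)[OF fI relabel_\<pi>_carrier[OF h]] by (simp add: relabel_\<pi>_\<Phi>)
    qed
    then show "relabel UNIV \<Phi> f \<in> ?K" using relabel_\<Phi>_carrier[OF fc] by blast
  qed
  ultimately have "g \<in> ?K" using R.genideal_minimal g by blast
  moreover have "Poly_Mapping.single 0 1 \<in> (carrier (mpoly_ring N) :: 'a mpol set)"
    using R.one_closed by simp
  ultimately have "relabel (component b) \<pi> (Poly_Mapping.single 0 1 * g) \<in> I" by blast
  then show ?thesis by (simp add: mpol_one_mult)
qed

lemma fg_LT_ideal_transfer:
  fixes I :: "('a::{comm_ring,comm_monoid_mult}) mpol set"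
  assumes fg: "\<And>J :: 'a mpol set. fg_ideal (mpoly_ring N) J
      \<Longrightarrow> fg_ideal (mpoly_ring N) (LT_ideal N prec' J)"
    and I: "fg_ideal (mpoly_ring n) I"
  shows "fg_ideal (mpoly_ring n) (LT_ideal n prec I)"
proof -
  interpret P: ring "mpoly_ring n :: 'a mpol ring" by (rule ring_mpoly_ring)
  interpret R: ring "mpoly_ring N :: 'a mpol ring" by (rule ring_mpoly_ring)
  obtain F where F: "finite F" "F \<subseteq> carrier (mpoly_ring n)" "I = genideal (mpoly_ring n) F"
    using I by (auto simp: fg_ideal_def)
  have idI: "ideal I (mpoly_ring n)" unfolding F(3) by (rule P.genideal_ideal[OF F(2)])
  have FI: "F \<subseteq> I" unfolding F(3) by (rule P.genideal_self[OF F(2)])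
  have Ic: "I \<subseteq> carrier (mpoly_ring n)" by (rule mpoly_idealD(1)[OF idI])
  define J where "J = genideal (mpoly_ring N) (relabel UNIV \<Phi> ` F)"
  have \<Phi>F: "relabel UNIV \<Phi> ` F \<subseteq> carrier (mpoly_ring N)" using F relabel_\<Phi>_carrier by blast
  have idJ: "ideal J (mpoly_ring N)" unfolding J_def by (rule R.genideal_ideal[OF \<Phi>F])
  have Jc: "J \<subseteq> carrier (mpoly_ring N)" by (rule mpoly_idealD(1)[OF idJ])
  have "fg_ideal (mpoly_ring N) J"
    unfolding fg_ideal_def J_def by (intro exI[of _ "relabel UNIV \<Phi> ` F"] conjI finite_imageI F(1) \<Phi>F refl)
  from fg[OF this] obtain T where T: "finite T" "T \<subseteq> carrier (mpoly_ring N)"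
      "LT_ideal N prec' J = genideal (mpoly_ring N) T"
    unfolding fg_ideal_def by blast

  define A where "A = {LT prec f | f. f \<in> I \<and> f \<noteq> 0}"
  define B where "B = {LT prec' g | g. g \<in> J \<and> g \<noteq> 0}"
  have Ac: "A \<subseteq> carrier (mpoly_ring n)" unfolding A_def using Ic LT_carrier[OF mo] by auto
  have Bc: "B \<subseteq> carrier (mpoly_ring N)" unfolding B_def using Jc LT_carrier[OF mo'] by auto
  have idA: "ideal (genideal (mpoly_ring n) A) (mpoly_ring n)" by (rule P.genideal_ideal[OF Ac])

  have "relabel UNIV \<Phi> ` genideal (mpoly_ring n) F \<subseteq> J"
  proof (rule relabel_genideal_subset[OF \<Phi>_add \<Phi>_expos F(2) idJ])
    show "relabel UNIV \<Phi> ` F \<subseteq> J" unfolding J_def by (rule R.genideal_self[OF \<Phi>F])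
  qed
  then have \<Phi>I: "relabel UNIV \<Phi> f \<in> J" if "f \<in> I" for f using that F(3) by auto

  \<comment> \<open>Leading terms of \<open>I\<close> come from \<open>J\<close>, as \<open>LT (\<phi> f) = \<phi> (LT f)\<close>.\<close>
  have AB: "A \<subseteq> relabel UNIV \<pi> ` B"
  proof
    fix t assume "t \<in> A"
    then obtain f where f: "f \<in> I" "f \<noteq> 0" "t = LT prec f" unfolding A_def by blast
    have fc: "Poly_Mapping.keys f \<subseteq> expos n" using f Ic by auto
    have lead: "lead_expo prec f \<in> expos n" using lead_expo(1)[OF mo fc f(2)] fc by blast
    have mono: "\<forall>b\<in>expos n \<inter> UNIV. prec b (lead_expo prec f) \<longrightarrow> prec' (\<Phi> b) (\<Phi> (lead_expo prec f))"
      using prec_\<Phi>[OF _ lead] by simp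
    note LT = LT_relabel[OF mo mo' fc f(2) \<Phi>_expos inj_\<Phi> UNIV_I mono]
    have "LT prec' (relabel UNIV \<Phi> f) \<in> B" unfolding B_def using \<Phi>I[OF f(1)] LT(1) by blast
    moreover have "t = relabel UNIV \<pi> (LT prec' (relabel UNIV \<Phi> f))"
      using LT(2) f(3) by (simp add: relabel_\<pi>_\<Phi>)
    ultimately show "t \<in> relabel UNIV \<pi> ` B" by (rule rev_image_eqI)
  qed

  \<comment> \<open>The component of \<open>g\<close> that contains its leading term has its image in \<open>I\<close>, with leading term
    the image of \<open>LT g\<close>.\<close>
  have BA: "relabel UNIV \<pi> ` B \<subseteq> A"
  proof
    fix t assume "t \<in> relabel UNIV \<pi> ` B"
    then obtain g where g: "g \<in> J" "g \<noteq> 0" "t = relabel UNIV \<pi> (LT prec' g)" unfolding B_def by blast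
    have gc: "Poly_Mapping.keys g \<subseteq> expos N" using g Jc by auto
    let ?b = "lead_expo prec' g"
    have lead: "?b \<in> expos N" using lead_expo(1)[OF mo' gc g(2)] gc by blast
    have mono: "\<forall>a\<in>expos N \<inter> component ?b. prec' a ?b \<longrightarrow> prec (\<pi> a) (\<pi> ?b)"
      using prec_component[OF _ lead] by simp
    note LT = LT_relabel[OF mo' mo gc g(2) \<pi>_expos inj_on_component component_self mono]
    have "relabel (component ?b) \<pi> g \<in> I"
      using component_in_ideal[OF idI FI] g(1) by (simp only: J_def)
    then have "LT prec (relabel (component ?b) \<pi> g) \<in> A" unfolding A_def using LT(1) by blast
    then show "t \<in> A" by (simp only: g(3) LT(2))
  qed

  have \<pi>T: "relabel UNIV \<pi> ` T \<subseteq> carrier (mpoly_ring n)" using T(2) relabel_\<pi>_carrier by blast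
  have "genideal (mpoly_ring n) A = genideal (mpoly_ring n) (relabel UNIV \<pi> ` T)"
  proof
    have "relabel UNIV \<pi> ` genideal (mpoly_ring N) T \<subseteq> genideal (mpoly_ring n) (relabel UNIV \<pi> ` T)"
      by (rule relabel_genideal_subset[OF \<pi>_add \<pi>_expos T(2) P.genideal_ideal[OF \<pi>T] P.genideal_self[OF \<pi>T]])
    moreover have "B \<subseteq> genideal (mpoly_ring N) T"
      using R.genideal_self[OF Bc] T(3) by (simp add: LT_ideal_def B_def)
    ultimately have "A \<subseteq> genideal (mpoly_ring n) (relabel UNIV \<pi> ` T)" using AB by blast
    then show "genideal (mpoly_ring n) A \<subseteq> genideal (mpoly_ring n) (relabel UNIV \<pi> ` T)"
      by (rule P.genideal_minimal[OF P.genideal_ideal[OF \<pi>T]])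
  next
    have "relabel UNIV \<pi> ` B \<subseteq> genideal (mpoly_ring n) A"
      using BA P.genideal_self[OF Ac] by blast
    then have "relabel UNIV \<pi> ` genideal (mpoly_ring N) B \<subseteq> genideal (mpoly_ring n) A"
      by (rule relabel_genideal_subset[OF \<pi>_add \<pi>_expos Bc idA])
    moreover have "T \<subseteq> genideal (mpoly_ring N) B"
      using R.genideal_self[OF T(2)] T(3) by (simp add: LT_ideal_def B_def)
    ultimately have "relabel UNIV \<pi> ` T \<subseteq> genideal (mpoly_ring n) A" by blast
    then show "genideal (mpoly_ring n) (relabel UNIV \<pi> ` T) \<subseteq> genideal (mpoly_ring n) A"
      by (rule P.genideal_minimal[OF idA])
  qed
  then show ?thesis
    unfolding fg_ideal_def LT_ideal_def A_def[symmetric] using T(1) \<pi>T by blast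
qed

end

section \<open>The lexicographic order\<close>

lemma lex_order_trans:
  assumes "lex_order n \<alpha> \<beta>" "lex_order n \<beta> \<gamma>"
  shows "lex_order n \<alpha> \<gamma>"
proof -
  obtain i k where i: "i < n" "\<forall>j<i. Poly_Mapping.lookup \<alpha> j = Poly_Mapping.lookup \<beta> j"
      "Poly_Mapping.lookup \<alpha> i < Poly_Mapping.lookup \<beta> i"
    and k: "k < n" "\<forall>j<k. Poly_Mapping.lookup \<beta> j = Poly_Mapping.lookup \<gamma> j"
      "Poly_Mapping.lookup \<beta> k < Poly_Mapping.lookup \<gamma> k"
    using assms unfolding lex_order_def by auto
  show ?thesis
    unfolding lex_order_def
    by (rule exI[of _ "min i k"], cases i k rule: linorder_cases) (use i k in auto)
qed

lemma lex_order_total: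
  assumes "\<alpha> \<in> expos n" "\<beta> \<in> expos n" "\<alpha> \<noteq> \<beta>"
  shows "lex_order n \<alpha> \<beta> \<or> lex_order n \<beta> \<alpha>"
proof -
  let ?P = "\<lambda>i. Poly_Mapping.lookup \<alpha> i \<noteq> Poly_Mapping.lookup \<beta> i"
  obtain j where j: "?P j" using assms(3) by (auto simp: poly_mapping_eq_iff fun_eq_iff)
  define i where "i = (LEAST i. ?P i)"
  have i: "?P i" unfolding i_def using j by (rule LeastI)
  have min: "\<not> ?P k" if "k < i" for k using not_less_Least[of k ?P] that by (simp add: i_def)
  have "i \<in> Poly_Mapping.keys \<alpha> \<union> Poly_Mapping.keys \<beta>" using i by (auto simp: in_keys_iff)
  then have "i < n" using assms(1,2) by (auto simp: expos_def)
  then show ?thesis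
    using i min unfolding lex_order_def
    by (cases "Poly_Mapping.lookup \<alpha> i" "Poly_Mapping.lookup \<beta> i" rule: linorder_cases) auto
qed

text \<open>
  Among the elements that are minimal in the first \<open>n\<close> coordinates, one takes the least possible next
  coordinate. Minimality is all one can ask for here: \<open>lex_order n\<close> only looks at the first \<open>n\<close>
  coordinates, and the induction on \<open>n\<close> runs with \<open>S\<close> fixed.
\<close>

lemma lex_order_minimal:
  assumes "S \<noteq> {}"
  shows "\<exists>\<alpha>\<in>S. \<forall>\<beta>\<in>S. \<not> lex_order n \<beta> \<alpha>"
proof (induction n)
  case 0
  then show ?case using assms by (auto simp: lex_order_def)
next
  case (Suc n)
  then obtain \<alpha> where \<alpha>: "\<alpha> \<in> S" "\<forall>\<beta>\<in>S. \<not> lex_order n \<beta> \<alpha>" by blast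
  let ?P = "\<lambda>\<beta>. \<beta> \<in> S \<and> (\<forall>j<n. Poly_Mapping.lookup \<beta> j = Poly_Mapping.lookup \<alpha> j)"
  obtain \<gamma> where \<gamma>: "?P \<gamma>" "\<And>\<beta>. ?P \<beta> \<Longrightarrow> Poly_Mapping.lookup \<gamma> n \<le> Poly_Mapping.lookup \<beta> n"
    using ex_has_least_nat[of ?P \<alpha> "\<lambda>\<beta>. Poly_Mapping.lookup \<beta> n"] \<alpha> by auto
  have "\<not> lex_order (Suc n) \<beta> \<gamma>" if \<beta>: "\<beta> \<in> S" for \<beta>
  proof
    assume "lex_order (Suc n) \<beta> \<gamma>"
    then obtain i where i: "i < Suc n" "\<forall>j<i. Poly_Mapping.lookup \<beta> j = Poly_Mapping.lookup \<gamma> j"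
      "Poly_Mapping.lookup \<beta> i < Poly_Mapping.lookup \<gamma> i"
      unfolding lex_order_def by blast
    show False
    proof (cases "i = n")
      case True
      then have "?P \<beta>" using \<beta> i \<gamma>(1) by simp
      then show False using \<gamma>(2)[of \<beta>] i(3) True by simp
    next
      case False
      then have "lex_order n \<beta> \<alpha>"
        unfolding lex_order_def using i \<gamma>(1) by (intro exI[of _ i]) auto
      then show False using \<alpha>(2) \<beta> by blast
    qed
  qed
  then show ?case using \<gamma>(1) by blast
qed

lemma monomial_order_lex: "monomial_order n (lex_order n)"
  unfolding monomial_order_def
proof (intro conjI ballI allI impI)
  show "\<not> lex_order n \<alpha> \<alpha>" for \<alpha> by (simp add: lex_order_def)
  show "lex_order n \<alpha> \<gamma>" if "lex_order n \<alpha> \<beta>" "lex_order n \<beta> \<gamma>" for \<alpha> \<beta> \<gamma>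
    using that by (rule lex_order_trans)
  show "\<alpha> = \<beta> \<or> lex_order n \<alpha> \<beta> \<or> lex_order n \<beta> \<alpha>" if "\<alpha> \<in> expos n" "\<beta> \<in> expos n" for \<alpha> \<beta>
    using lex_order_total that by blast
  show "0 = \<alpha> \<or> lex_order n 0 \<alpha>" if "\<alpha> \<in> expos n" for \<alpha>
    using lex_order_total[OF expos_0 that] by (auto simp: lex_order_def)
  show "lex_order n (\<alpha> + \<gamma>) (\<beta> + \<gamma>)" if "lex_order n \<alpha> \<beta>" for \<alpha> \<beta> \<gamma>
    using that by (simp add: lex_order_def lookup_add)
  show "\<exists>\<alpha>\<in>S. \<forall>\<beta>\<in>S. \<alpha> = \<beta> \<or> lex_order n \<alpha> \<beta>" if S: "S \<subseteq> expos n" "S \<noteq> {}" for S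
  proof -
    obtain \<alpha> where \<alpha>: "\<alpha> \<in> S" "\<forall>\<beta>\<in>S. \<not> lex_order n \<beta> \<alpha>"
      using lex_order_minimal[OF S(2)] by blast
    have "\<alpha> = \<beta> \<or> lex_order n \<alpha> \<beta>" if "\<beta> \<in> S" for \<beta>
      using lex_order_total[of \<alpha> n \<beta>] \<alpha> that S(1) by auto
    then show ?thesis using \<alpha>(1) by auto
  qed
qed

lemma rational_order_lex: "rational_order n (lex_order n)"
proof -
  have eq: "lex_order n \<alpha> \<beta> \<longleftrightarrow>
      lex_less (1\<^sub>m n *\<^sub>v expo_vec n \<alpha>) (1\<^sub>m n *\<^sub>v expo_vec n \<beta>)" for \<alpha> \<beta>
  proof -
    have id: "1\<^sub>m n *\<^sub>v expo_vec n \<gamma> = expo_vec n \<gamma>" for \<gamma>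
      by (simp add: expo_vec_def)
    have dim: "dim_vec (expo_vec n \<alpha>) = n" by (simp add: expo_vec_def)
    have "k < n \<and> (\<forall>j<k. Poly_Mapping.lookup \<alpha> j = Poly_Mapping.lookup \<beta> j) \<and>
          Poly_Mapping.lookup \<alpha> k < Poly_Mapping.lookup \<beta> k \<longleftrightarrow>
        k < n \<and> (\<forall>j<k. expo_vec n \<beta> $ j - expo_vec n \<alpha> $ j = 0) \<and>
          expo_vec n \<beta> $ k - expo_vec n \<alpha> $ k > 0" for k
      by (auto simp: expo_vec_def)
    then show ?thesis unfolding lex_less_def lex_order_def id dim by (simp only:)
  qed
  show ?thesis
    unfolding rational_order_def
    by (intro conjI monomial_order_lex exI[of _ n] bexI[of _ "1\<^sub>m n"] ballI one_carrier_mat eq)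
qed

section \<open>Nonnegative integer weights\<close>

lemma common_denominator:
  fixes S :: "rat set"
  assumes "finite S"
  shows "\<exists>D::int. D > 0 \<and> (\<forall>x\<in>S. of_int D * x \<in> \<int>)"
  using assms
proof (induction S)
  case empty
  show ?case by (intro exI[of _ 1]) auto
next
  case (insert x S)
  then obtain D :: int where D: "D > 0" "\<forall>x\<in>S. of_int D * x \<in> \<int>" by blast
  obtain a b :: int where ab: "b > 0" "x = of_int a / of_int b"
    by (metis quotient_of_denom_pos quotient_of_div surj_pair)
  have "of_int (b * D) * y \<in> \<int>" if "y \<in> insert x S" for y
  proof (cases "y = x")
    case True
    have "of_int (b * D) * y = of_int (D * a)" using ab True by simp
    then show ?thesis by (metis Ints_of_int)
  next
    case False
    then have "of_int D * y \<in> \<int>" using D that by auto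
    then have "of_int b * (of_int D * y) \<in> \<int>" by (rule Ints_mult[OF Ints_of_int])
    then show ?thesis by (simp only: of_int_mult mult.assoc)
  qed
  then show ?case using D(1) ab(1) by (intro exI[of _ "b * D"]) simp
qed

text \<open>
  The row operations, read along one column or along one vector \<open>Q \<alpha>\<close>: each new row is the old one
  plus \<open>c\<close> times the new row before it. This is a unitriangular integer transformation, hence it
  preserves lexicographic comparison (\<open>accumulate_eq_iff\<close> and \<open>accumulate_less_iff\<close>), and the
  recursion makes nonnegativity a one-step induction.
\<close>

primrec accumulate :: "int \<Rightarrow> (nat \<Rightarrow> int) \<Rightarrow> nat \<Rightarrow> int" where
  "accumulate c x 0 = x 0"
| "accumulate c x (Suc k) = c * accumulate c x k + x (Suc k)"

lemma accumulate_sum: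
  "accumulate c (\<lambda>k. \<Sum>j\<in>A. f k j * a j) k = (\<Sum>j\<in>A. accumulate c (\<lambda>k. f k j) k * a j)"
  by (induction k) (simp_all add: sum_distrib_left sum.distrib[symmetric] algebra_simps)

lemma accumulate_eq_iff:
  "(\<forall>i<k. accumulate c x i = accumulate c y i) \<longleftrightarrow> (\<forall>i<k. x i = y i)"
proof (induction k)
  case (Suc k)
  have "(\<forall>i<k. x i = y i) \<Longrightarrow> accumulate c x k = accumulate c y k \<longleftrightarrow> x k = y k"
    using Suc by (cases k) auto
  then show ?case using Suc by (auto simp: less_Suc_eq)
qed simp

lemma accumulate_less_iff:
  assumes "\<forall>i<k. x i = y i"
  shows "accumulate c x k < accumulate c y k \<longleftrightarrow> x k < y k"
  using assms accumulate_eq_iff[of k c x y] by (cases k) auto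

text \<open>
  Up to the first positive entry nothing changes. From there on the values stay at least \<open>1\<close>,
  because \<open>c * 1\<close> outweighs any later entry.
\<close>

lemma accumulate_nonneg:
  assumes first: "\<forall>i<k0. x i = 0" "x k0 > 0" and c: "\<And>k. k < m \<Longrightarrow> \<bar>x k\<bar> < c" and k: "k < m"
  shows "accumulate c x k \<ge> 0"
proof -
  have "if k < k0 then accumulate c x k = 0 else accumulate c x k \<ge> 1"
    using k
  proof (induction k)
    case 0
    then show ?case using first by auto
  next
    case (Suc k)
    consider "Suc k < k0" | "Suc k = k0" | "k0 \<le> k" by linarith
    then show ?case
    proof cases
      case 3
      then have "accumulate c x k \<ge> 1" using Suc by auto
      moreover have "\<bar>x (Suc k)\<bar> < c" using c Suc.prems by blast
      ultimately have "c * accumulate c x k \<ge> c * 1" by (intro mult_left_mono) auto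
      then show ?thesis using 3 \<open>\<bar>x (Suc k)\<bar> < c\<close> by auto
    qed (use Suc first in auto)
  qed
  then show ?thesis by (auto split: if_splits)
qed

definition weight :: "nat \<Rightarrow> (nat \<Rightarrow> nat) \<Rightarrow> expo \<Rightarrow> nat" where
  "weight n v \<alpha> = (\<Sum>j<n. v j * Poly_Mapping.lookup \<alpha> j)"

lemma nat_weights_exist:
  fixes Q :: "rat mat"
  assumes Q: "Q \<in> carrier_mat m n"
    and first: "\<And>j. j < n \<Longrightarrow> \<exists>k<m. (\<forall>i<k. Q $$ (i, j) = 0) \<and> Q $$ (k, j) > 0"
  obtains w :: "nat \<Rightarrow> nat \<Rightarrow> nat" where
    "\<And>\<alpha> \<beta>. lex_less (Q *\<^sub>v expo_vec n \<alpha>) (Q *\<^sub>v expo_vec n \<beta>) \<longleftrightarrow>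
      (\<exists>k<m. (\<forall>i<k. weight n (w i) \<alpha> = weight n (w i) \<beta>) \<and> weight n (w k) \<alpha> < weight n (w k) \<beta>)"
proof -
  obtain D :: int where D: "D > 0" "\<forall>x\<in>(\<lambda>(k, j). Q $$ (k, j)) ` ({..<m} \<times> {..<n}). of_int D * x \<in> \<int>"
    using common_denominator[of "(\<lambda>(k, j). Q $$ (k, j)) ` ({..<m} \<times> {..<n})"] by auto
  define q where "q k j = \<lfloor>of_int D * Q $$ (k, j)\<rfloor>" for k j
  have q: "of_int (q k j) = of_int D * Q $$ (k, j)" if "k < m" "j < n" for k j
  proof -
    have "of_int D * Q $$ (k, j) \<in> \<int>" using D(2) that by auto
    then show ?thesis by (auto simp: q_def elim: Ints_cases)
  qed
  \<comment> \<open>Any bound on the entries of the cleared matrix does.\<close>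
  define c where "c = 1 + (\<Sum>k<m. \<Sum>j<n. \<bar>q k j\<bar>)"
  have c: "\<bar>q k j\<bar> < c" if "k < m" "j < n" for k j
  proof -
    have "\<bar>q k j\<bar> \<le> (\<Sum>j<n. \<bar>q k j\<bar>)" using that by (intro member_le_sum) auto
    also have "\<dots> \<le> (\<Sum>k<m. \<Sum>j<n. \<bar>q k j\<bar>)"
      using that by (intro member_le_sum[of k _ "\<lambda>k. \<Sum>j<n. \<bar>q k j\<bar>"]) (auto intro: sum_nonneg)
    finally show ?thesis by (simp add: c_def)
  qed
  define W where "W k j = accumulate c (\<lambda>k. q k j) k" for k j
  have W: "W k j \<ge> 0" if kj: "k < m" "j < n" for k j
  proof -
    obtain k0 where k0: "k0 < m" "\<forall>i<k0. Q $$ (i, j) = 0" "Q $$ (k0, j) > 0"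
      using first kj by blast
    have "\<forall>i<k0. q i j = 0" using k0 by (simp add: q_def)
    moreover have "q k0 j > 0"
    proof -
      have "(of_int (q k0 j) :: rat) > 0" using q[OF k0(1) kj(2)] k0(3) D(1) by simp
      then show ?thesis by simp
    qed
    ultimately show ?thesis
      unfolding W_def by (rule accumulate_nonneg) (use c kj in auto)
  qed
  define row where "row \<alpha> k = (\<Sum>j<n. q k j * int (Poly_Mapping.lookup \<alpha> j))" for \<alpha> k
  have row: "of_int (row \<alpha> k) = of_int D * (Q *\<^sub>v expo_vec n \<alpha>) $ k" if "k < m" for \<alpha> k
  proof -
    have "(Q *\<^sub>v expo_vec n \<alpha>) $ k = (\<Sum>j<n. Q $$ (k, j) * of_nat (Poly_Mapping.lookup \<alpha> j))"
      using that Q by (auto simp: expo_vec_def scalar_prod_def lessThan_atLeast0 intro!: sum.cong)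
    then show ?thesis
      using that by (auto simp: row_def sum_distrib_left q mult.assoc[symmetric] intro!: sum.cong)
  qed
  define w where "w k j = nat (W k j)" for k j
  have weight: "int (weight n (w k) \<alpha>) = accumulate c (row \<alpha>) k" if "k < m" for \<alpha> k
  proof -
    have "accumulate c (row \<alpha>) k = (\<Sum>j<n. W k j * int (Poly_Mapping.lookup \<alpha> j))"
      unfolding row_def W_def by (rule accumulate_sum)
    then show ?thesis using that by (simp add: weight_def w_def W)
  qed
  have "lex_less (Q *\<^sub>v expo_vec n \<alpha>) (Q *\<^sub>v expo_vec n \<beta>) \<longleftrightarrow>
      (\<exists>k<m. (\<forall>i<k. weight n (w i) \<alpha> = weight n (w i) \<beta>) \<and> weight n (w k) \<alpha> < weight n (w k) \<beta>)"
    for \<alpha> \<beta>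
  proof -
    let ?a = "\<lambda>k. (Q *\<^sub>v expo_vec n \<alpha>) $ k" and ?b = "\<lambda>k. (Q *\<^sub>v expo_vec n \<beta>) $ k"
    have eq: "?b k - ?a k = 0 \<longleftrightarrow> row \<alpha> k = row \<beta> k"
      and less: "?b k - ?a k > 0 \<longleftrightarrow> row \<alpha> k < row \<beta> k" if "k < m" for k
    proof -
      have "of_int (row \<beta> k - row \<alpha> k) = of_int D * (?b k - ?a k)"
        using row[OF that] by (simp add: right_diff_distrib)
      moreover have "(of_int D :: rat) > 0" using D(1) by simp
      ultimately have "?b k - ?a k = of_int (row \<beta> k - row \<alpha> k) / of_int D"
        by (simp add: field_simps)
      then show "?b k - ?a k = 0 \<longleftrightarrow> row \<alpha> k = row \<beta> k" "?b k - ?a k > 0 \<longleftrightarrow> row \<alpha> k < row \<beta> k"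
        using D(1) by (auto simp: zero_less_divide_iff)
    qed
    have "lex_less (Q *\<^sub>v expo_vec n \<alpha>) (Q *\<^sub>v expo_vec n \<beta>) \<longleftrightarrow>
        (\<exists>k<m. (\<forall>i<k. row \<alpha> i = row \<beta> i) \<and> row \<alpha> k < row \<beta> k)"
    proof -
      have dim: "dim_vec (Q *\<^sub>v expo_vec n \<alpha>) = m" using Q by simp
      have "(\<forall>j<k. ?b j - ?a j = 0) \<and> ?b k - ?a k > 0 \<longleftrightarrow>
          (\<forall>i<k. row \<alpha> i = row \<beta> i) \<and> row \<alpha> k < row \<beta> k" if "k < m" for k
      proof -
        have "(?b j - ?a j = 0) = (row \<alpha> j = row \<beta> j)" if "j < k" for j
          by (rule eq) (use that \<open>k < m\<close> in simp)
        then show ?thesis using less[OF that] by blast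
      qed
      then show ?thesis unfolding lex_less_def dim by blast
    qed
    also have "\<dots> \<longleftrightarrow> (\<exists>k<m. (\<forall>i<k. accumulate c (row \<alpha>) i = accumulate c (row \<beta>) i) \<and>
        accumulate c (row \<alpha>) k < accumulate c (row \<beta>) k)"
    proof -
      have "(\<forall>i<k. row \<alpha> i = row \<beta> i) \<and> row \<alpha> k < row \<beta> k \<longleftrightarrow>
          (\<forall>i<k. accumulate c (row \<alpha>) i = accumulate c (row \<beta>) i) \<and>
          accumulate c (row \<alpha>) k < accumulate c (row \<beta>) k" for k
        using accumulate_eq_iff[of k c "row \<alpha>" "row \<beta>"]
          accumulate_less_iff[of k "row \<alpha>" "row \<beta>" c] by blast
      then show ?thesis by simp
    qed
    also have "\<dots> \<longleftrightarrow>
      (\<exists>k<m. (\<forall>i<k. weight n (w i) \<alpha> = weight n (w i) \<beta>) \<and> weight n (w k) \<alpha> < weight n (w k) \<beta>)"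
      by (auto simp: weight[symmetric])
    finally show ?thesis .
  qed
  then show thesis by (rule that)
qed

section \<open>Rational orders as restrictions of lexicographic orders\<close>

text \<open>The exponent of \<open>Y\<^sup>W\<^sup>\<alpha> X\<^sup>\<alpha>\<close>, with the \<open>m\<close> variables \<open>Y\<close> in front.\<close>

definition expo_lift :: "nat \<Rightarrow> nat \<Rightarrow> (nat \<Rightarrow> nat \<Rightarrow> nat) \<Rightarrow> expo \<Rightarrow> expo" where
  "expo_lift m n w \<alpha> = Abs_poly_mapping
    (\<lambda>k. if k < m then weight n (w k) \<alpha> else Poly_Mapping.lookup \<alpha> (k - m))"

definition expo_drop :: "nat \<Rightarrow> expo \<Rightarrow> expo" where
  "expo_drop m = Poly_Mapping.map_key (\<lambda>j. j + m)"

lemma lookup_expo_lift: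
  "Poly_Mapping.lookup (expo_lift m n w \<alpha>) k =
    (if k < m then weight n (w k) \<alpha> else Poly_Mapping.lookup \<alpha> (k - m))"
proof -
  have "finite ({..<m} \<union> (\<lambda>j. j + m) ` Poly_Mapping.keys \<alpha>)" by simp
  moreover have "{k. (if k < m then weight n (w k) \<alpha> else Poly_Mapping.lookup \<alpha> (k - m)) \<noteq> 0}
      \<subseteq> {..<m} \<union> (\<lambda>j. j + m) ` Poly_Mapping.keys \<alpha>"
  proof
    fix k
    assume "k \<in> {k. (if k < m then weight n (w k) \<alpha> else Poly_Mapping.lookup \<alpha> (k - m)) \<noteq> 0}"
    then have k: "k < m \<or> k - m \<in> Poly_Mapping.keys \<alpha>"
      by (auto simp: in_keys_iff split: if_splits)
    show "k \<in> {..<m} \<union> (\<lambda>j. j + m) ` Poly_Mapping.keys \<alpha>"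
    proof (cases "k < m")
      case False
      then have "(\<lambda>j. j + m) (k - m) \<in> (\<lambda>j. j + m) ` Poly_Mapping.keys \<alpha>"
        using k by (intro imageI) simp
      with False show ?thesis by simp
    qed simp
  qed
  ultimately have "finite {k. (if k < m then weight n (w k) \<alpha> else Poly_Mapping.lookup \<alpha> (k - m)) \<noteq> 0}"
    by (rule finite_subset[rotated])
  then show ?thesis by (simp only: expo_lift_def lookup_Abs_poly_mapping)
qed

lemma lookup_expo_drop: "Poly_Mapping.lookup (expo_drop m \<alpha>) j = Poly_Mapping.lookup \<alpha> (j + m)"
  by (simp add: expo_drop_def map_key.rep_eq)

lemma expos_iff: "\<alpha> \<in> expos n \<longleftrightarrow> (\<forall>j\<ge>n. Poly_Mapping.lookup \<alpha> j = 0)"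
  by (auto simp: expos_def in_keys_iff subset_iff linorder_not_less[symmetric])

text \<open>
  The weights alone decide \<open>\<prec>\<close>, and they fill the first \<open>m\<close> coordinates of the lift. As \<open>\<prec>\<close> and the
  lexicographic order are both total, monotonicity of the lift already gives the equivalence.
\<close>

lemma expo_embedding_of_rational_order:
  assumes "rational_order n prec"
  obtains m \<Phi> \<pi> where "expo_embedding n (m + n) prec (lex_order (m + n)) \<Phi> \<pi>"
proof -
  have mo: "monomial_order n prec" using assms by (simp add: rational_order_def)
  obtain m Q where Q: "Q \<in> carrier_mat m n" and prec: "\<And>\<alpha> \<beta>. \<alpha> \<in> expos n \<Longrightarrow> \<beta> \<in> expos n \<Longrightarrow>
      prec \<alpha> \<beta> \<longleftrightarrow> lex_less (Q *\<^sub>v expo_vec n \<alpha>) (Q *\<^sub>v expo_vec n \<beta>)"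
    using assms unfolding rational_order_def by blast
  have "\<exists>k<m. (\<forall>i<k. Q $$ (i, j) = 0) \<and> Q $$ (k, j) > 0" if j: "j < n" for j
  proof -
    let ?e = "Poly_Mapping.single j 1 :: expo"
    have e: "?e \<in> expos n" using j by (simp add: expos_def)
    have "0 \<noteq> ?e" by (metis lookup_single_eq lookup_zero zero_neq_one)
    then have "prec 0 ?e" using monomial_orderD(4)[OF mo e e] by blast
    then have "lex_less (Q *\<^sub>v expo_vec n 0) (Q *\<^sub>v expo_vec n ?e)" using prec e by simp
    moreover have "(Q *\<^sub>v expo_vec n 0) $ k = 0" if "k < m" for k
      using that Q by (auto simp: expo_vec_def scalar_prod_def)
    moreover have "(Q *\<^sub>v expo_vec n ?e) $ k = Q $$ (k, j)" if "k < m" for k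
    proof -
      have "(Q *\<^sub>v expo_vec n ?e) $ k =
          (\<Sum>i=0..<n. Q $$ (k, i) * of_nat (Poly_Mapping.lookup ?e i))"
        using that Q by (auto simp: expo_vec_def scalar_prod_def intro!: sum.cong)
      also have "\<dots> = (\<Sum>i=0..<n. if i = j then Q $$ (k, i) else 0)"
        by (rule sum.cong) (auto simp: lookup_single when_def)
      finally show ?thesis using j by simp
    qed
    ultimately show ?thesis unfolding lex_less_def using Q by auto
  qed
  from nat_weights_exist[OF Q this] obtain w where w:
    "\<And>\<alpha> \<beta>. lex_less (Q *\<^sub>v expo_vec n \<alpha>) (Q *\<^sub>v expo_vec n \<beta>) \<longleftrightarrow>
      (\<exists>k<m. (\<forall>i<k. weight n (w i) \<alpha> = weight n (w i) \<beta>) \<and> weight n (w k) \<alpha> < weight n (w k) \<beta>)"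
    by blast
  let ?\<Phi> = "expo_lift m n w"
  have lift: "?\<Phi> \<alpha> \<in> expos (m + n)" if "\<alpha> \<in> expos n" for \<alpha>
    using that by (auto simp: expos_iff lookup_expo_lift)
  have mono: "lex_order (m + n) (?\<Phi> \<alpha>) (?\<Phi> \<beta>)"
    if ab: "\<alpha> \<in> expos n" "\<beta> \<in> expos n" "prec \<alpha> \<beta>" for \<alpha> \<beta>
  proof -
    obtain k where "k < m" "\<forall>i<k. weight n (w i) \<alpha> = weight n (w i) \<beta>"
      "weight n (w k) \<alpha> < weight n (w k) \<beta>"
      using prec[OF ab(1,2)] ab(3) w by blast
    then show ?thesis
      unfolding lex_order_def by (intro exI[of _ k]) (simp add: lookup_expo_lift)
  qed
  have "expo_embedding n (m + n) prec (lex_order (m + n)) ?\<Phi> (expo_drop m)"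
  proof
    show "?\<Phi> (a + b) = ?\<Phi> a + ?\<Phi> b" for a b
      by (rule poly_mapping_eqI)
        (simp add: lookup_expo_lift lookup_add weight_def distrib_left sum.distrib)
    show "expo_drop m (a + b) = expo_drop m a + expo_drop m b" for a b
      by (rule poly_mapping_eqI) (simp add: lookup_expo_drop lookup_add)
    show "expo_drop m (?\<Phi> a) = a" for a
      by (rule poly_mapping_eqI) (simp add: lookup_expo_drop lookup_expo_lift)
    show "expo_drop m ` expos (m + n) \<subseteq> expos n"
      by (auto simp: expos_iff lookup_expo_drop)
    show "prec a b \<longleftrightarrow> lex_order (m + n) (?\<Phi> a) (?\<Phi> b)" if ab: "a \<in> expos n" "b \<in> expos n" for a b
    proof
      assume lex: "lex_order (m + n) (?\<Phi> a) (?\<Phi> b)"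
      note D = monomial_orderD[OF monomial_order_lex lift[OF ab(1)] lift[OF ab(2)]]
      have "a \<noteq> b" using D(1) lex by auto
      moreover have "\<not> prec b a" using mono[OF ab(2,1)] D(3) lex by blast
      ultimately show "prec a b" using monomial_orderD(2)[OF mo ab] by blast
    qed (use mono ab in blast)
  qed (use mo monomial_order_lex lift in auto)
  then show thesis by (rule that)
qed

theorem mainTheorem1:
  shows "(\<forall>n\<ge>1. \<forall>prec. rational_order n prec \<longrightarrow>
            (\<forall>I :: ('a::{comm_ring,comm_monoid_mult}) mpol set.
               fg_ideal (mpoly_ring n) I \<longrightarrow>
               fg_ideal (mpoly_ring n) (LT_ideal n prec I)))
         \<longleftrightarrow> groebner_ring TYPE('a)"
    (is "?rational \<longleftrightarrow> _")
proof
  assume ?rational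
  then show "groebner_ring TYPE('a)"
    unfolding groebner_ring_def n_groebner_def using rational_order_lex by blast
next
  assume G: "groebner_ring TYPE('a)"
  show ?rational
  proof (intro allI impI)
    fix n prec and I :: "'a mpol set"
    assume n: "1 \<le> n" and prec: "rational_order n prec" and I: "fg_ideal (mpoly_ring n) I"
    obtain m \<Phi> \<pi> where "expo_embedding n (m + n) prec (lex_order (m + n)) \<Phi> \<pi>"
      using expo_embedding_of_rational_order[OF prec] .
    then interpret expo_embedding n "m + n" prec "lex_order (m + n)" \<Phi> \<pi> .
    have "n_groebner (m + n) TYPE('a)" using G n by (simp add: groebner_ring_def)
    then show "fg_ideal (mpoly_ring n) (LT_ideal n prec I)"
      by (intro fg_LT_ideal_transfer I) (simp add: n_groebner_def)
  qed
qed

end
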